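(* Let $\mathbb{F}$ be a field, let $G$ be a finite group with a subgroup $H$, and let $X$ be a finite nonempty set. If $G$ acts freely on $X$, then $$\frac{\dim(L^H(X))}{\dim(L^G(X))}=[G\colon H],$$ where $[G\colon H]$ denotes the index of $H$ in $G$.
   Context: An action of $G$ on $X$, written $a\cdot x$, is free if for all $a\in G$, $x\in X$, $a\cdot x=x$ implies $a=e$, the identity of $G$. $L(X)$ denotes the $\mathbb{F}$-vector space of all functions from $X$ to $\mathbb{F}$ with pointwise operations. For a subgroup $H$ of $G$ (including $H=G$), acting on $X$ by restriction of the $G$-action, $L^H(X)=\{f\in L(X)\colon f(a\cdot x)=f(x)\text{ for all }a\in H, x\in X\}$. Dimensions are over $\mathbb{F}$. *)

theory Defs
  imports
    Complex_Main
    "HOL-Algebra.Group_Action"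
    "Jordan_Normal_Form.Missing_VectorSpace"
begin

locale free_action = group_action +
  assumes free: "\<lbrakk> a \<in> carrier G; x \<in> E; (\<phi> a) x = x \<rbrakk> \<Longrightarrow> a = \<one>"

text \<open>
  \<open>L(X)\<close> is the space \<open>ring.func_space F X\<close>, whose elements are the functions from \<open>X\<close> to
  \<open>carrier F\<close> that are \<open>undefined\<close> outside \<open>X\<close>; hence each function on \<open>X\<close> is represented
  exactly once. The carrier of \<open>L\<^sup>H(X)\<close> only involves the maps \<open>\<phi> a\<close> with \<open>a \<in> H\<close>, that is,
  the restriction to \<open>H\<close> of the action \<open>\<phi>\<close>.
\<close>

definition invariant_functions ::
  "('f, 'r) ring_scheme \<Rightarrow> 'x set \<Rightarrow> ('g \<Rightarrow> 'x \<Rightarrow> 'x) \<Rightarrow> 'g set \<Rightarrow> ('x \<Rightarrow> 'f) set"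
  where "invariant_functions F X \<phi> H =
    {f \<in> carrier (ring.func_space F X). \<forall>a\<in>H. \<forall>x\<in>X. f (\<phi> a x) = f x}"

definition invariant_space ::
  "('f, 'r) ring_scheme \<Rightarrow> 'x set \<Rightarrow> ('g \<Rightarrow> 'x \<Rightarrow> 'x) \<Rightarrow> 'g set \<Rightarrow> ('f, 'x \<Rightarrow> 'f) module"
  where "invariant_space F X \<phi> H =
    (ring.func_space F X)\<lparr>carrier := invariant_functions F X \<phi> H\<rparr>"

lemma invariant_functions_subspace:
  assumes "field F" "group_action G X \<phi>" "H \<subseteq> carrier G"
  shows "subspace F (invariant_functions F X \<phi> H) (ring.func_space F X)"
proof -
  interpret F: field F by fact
  interpret A: group_action G X \<phi> by fact
  have cl: "\<phi> a x \<in> X" if "a \<in> H" "x \<in> X" for a x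
    using that assms(3) A.element_image by blast
  have "module F (ring.func_space F X)"
    by (rule F.func_space_is_module)
  then show ?thesis
    unfolding subspace_def submodule_def vectorspace_def
    using F.field_axioms cl
    by (auto simp: invariant_functions_def F.func_space_def PiE_mem)
qed

lemma invariant_space_vectorspace:
  assumes "field F" "group_action G X \<phi>" "H \<subseteq> carrier G"
  shows "vectorspace F (invariant_space F X \<phi> H)"
  using invariant_functions_subspace[OF assms]
  unfolding invariant_space_def subspace_def
  by (metis vectorspace.subspace_is_vs subspace_def)

end

theory Submission
  imports Defs
begin

text \<open>
  The indicator functions of the \<open>H\<close>-orbits form a basis of \<open>L\<^sup>H(X)\<close>, so its dimension is the
  number of \<open>H\<close>-orbits. As the action is free, every \<open>H\<close>-orbit has exactly \<open>|H|\<close> elements, whence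
  \<open>dim L\<^sup>H(X) \<cdot> |H| = |X| = dim L\<^sup>G(X) \<cdot> |G|\<close>, and Lagrange's theorem finishes the proof.
\<close>

lemma (in group_action) orbit_eqI:
  assumes "Q \<in> orbits G E \<phi>" "P \<in> orbits G E \<phi>" "x \<in> Q" "x \<in> P"
  shows "Q = P"
  using disjoint_union[OF assms(1,2)] assms(3,4) by blast

lemma (in group_action) orbits_nonempty: "Q \<in> orbits G E \<phi> \<Longrightarrow> Q \<noteq> {}"
  unfolding orbits_def using orbit_refl by auto

text \<open>Makes the indicator function of an orbit invariant: \<open>\<phi> g x\<close> and
  \<open>x\<close> both lie in the orbit of \<open>x\<close>, and distinct orbits are
  disjoint.\<close>

lemma (in group_action) image_mem_orbit_iff:
  assumes "Q \<in> orbits G E \<phi>" "g \<in> carrier G" "x \<in> E"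
  shows "\<phi> g x \<in> Q \<longleftrightarrow> x \<in> Q"
proof -
  have x: "orbit G \<phi> x \<in> orbits G E \<phi>" "x \<in> orbit G \<phi> x" "\<phi> g x \<in> orbit G \<phi> x"
    using assms(2,3) orbit_refl by (auto simp: orbits_def orbit_def)
  then show ?thesis
    using orbit_eqI[OF assms(1) x(1)] by blast
qed

lemma (in group_action) finite_orbits:
  assumes "finite E"
  shows "finite (orbits G E \<phi>)"
  using assms orbits_coverture finite_UnionD by metis

text \<open>Freeness makes the stabilizer trivial, so the orbit-stabilizer theorem leaves only the
  size of the orbit.\<close>

lemma (in free_action) card_orbit:
  assumes "x \<in> E"
  shows "card (orbit G \<phi> x) = order G"
proof -
  have "stabilizer G \<phi> x = {\<one>}"
    using stabilizer_one_closed[OF assms] free assms by (auto simp: stabilizer_def)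
  then show ?thesis
    using orbit_stabilizer_theorem[OF assms] by simp
qed

lemma (in free_action) card_orbits_mult_order:
  assumes "finite E"
  shows "card (orbits G E \<phi>) * order G = card E"
proof -
  have "card E = (\<Sum>Q\<in>orbits G E \<phi>. card Q)"
    using disjoint_sum[OF assms, of "\<lambda>_. 1::nat"] by simp
  also have "\<dots> = (\<Sum>Q\<in>orbits G E \<phi>. order G)"
    by (rule sum.cong) (auto simp: orbits_def card_orbit)
  finally show ?thesis
    by simp
qed

text \<open>Lets the orbit count be applied to \<open>H\<close> as a group in its own right; its
  identity is that of \<open>G\<close>, so freeness is inherited.\<close>

lemma (in free_action) induced_free_action:
  assumes "subgroup H G"
  shows "free_action (G\<lparr>carrier := H\<rparr>) E \<phi>"
  unfolding free_action_def free_action_axioms_def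
  using induced_action[OF assms] free subgroup.mem_carrier[OF assms] by auto

lemma invariant_space_simps:
  assumes "field F"
  shows "carrier (invariant_space F X \<phi> H) =
      {f \<in> X \<rightarrow>\<^sub>E carrier F. \<forall>a\<in>H. \<forall>x\<in>X. f (\<phi> a x) = f x}"
    and "\<zero>\<^bsub>invariant_space F X \<phi> H\<^esub> = (\<lambda>x\<in>X. \<zero>\<^bsub>F\<^esub>)"
    and "f \<oplus>\<^bsub>invariant_space F X \<phi> H\<^esub> g = (\<lambda>x\<in>X. f x \<oplus>\<^bsub>F\<^esub> g x)"
    and "c \<odot>\<^bsub>invariant_space F X \<phi> H\<^esub> f = (\<lambda>x\<in>X. c \<otimes>\<^bsub>F\<^esub> f x)"
proof -
  interpret F: field F by fact
  show "carrier (invariant_space F X \<phi> H) =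
      {f \<in> X \<rightarrow>\<^sub>E carrier F. \<forall>a\<in>H. \<forall>x\<in>X. f (\<phi> a x) = f x}"
    and "\<zero>\<^bsub>invariant_space F X \<phi> H\<^esub> = (\<lambda>x\<in>X. \<zero>\<^bsub>F\<^esub>)"
    and "f \<oplus>\<^bsub>invariant_space F X \<phi> H\<^esub> g = (\<lambda>x\<in>X. f x \<oplus>\<^bsub>F\<^esub> g x)"
    and "c \<odot>\<^bsub>invariant_space F X \<phi> H\<^esub> f = (\<lambda>x\<in>X. c \<otimes>\<^bsub>F\<^esub> f x)"
    by (simp_all add: invariant_space_def invariant_functions_def F.func_space_def)
qed

text \<open>Evaluation at a point is linear, so induction on \<open>S\<close> turns a sum in the
  function space into a sum in \<open>F\<close>. The point is taken in \<open>X\<close> because the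
  restricted operations return \<open>undefined\<close> elsewhere.\<close>

lemma invariant_space_lincomb_apply:
  assumes "field F" "group_action G X \<phi>" "H \<subseteq> carrier G"
    and "finite S" "S \<subseteq> carrier (invariant_space F X \<phi> H)" "c \<in> S \<rightarrow> carrier F" "x \<in> X"
  shows "module.lincomb (invariant_space F X \<phi> H) c S x = (\<Oplus>\<^bsub>F\<^esub>v\<in>S. c v \<otimes>\<^bsub>F\<^esub> v x)"
proof -
  interpret V: vectorspace F "invariant_space F X \<phi> H"
    using assms(1-3) by (rule invariant_space_vectorspace)
  note V_simps = invariant_space_simps[OF assms(1)]
  have val: "v x \<in> carrier F" if "v \<in> carrier (invariant_space F X \<phi> H)" for v
    using that assms(7) by (auto simp: V_simps)
  show ?thesis
    using assms(4-6)
  proof (induction S)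
    case empty
    then show ?case
      using assms(7) by (simp add: V.lincomb_def V_simps)
  next
    case (insert v S)
    have "V.lincomb c (insert v S) =
        c v \<odot>\<^bsub>invariant_space F X \<phi> H\<^esub> v \<oplus>\<^bsub>invariant_space F X \<phi> H\<^esub> V.lincomb c S"
      using insert by (intro V.lincomb_insert2) auto
    moreover have "(\<Oplus>\<^bsub>F\<^esub>w\<in>insert v S. c w \<otimes>\<^bsub>F\<^esub> w x) =
        c v \<otimes>\<^bsub>F\<^esub> v x \<oplus>\<^bsub>F\<^esub> (\<Oplus>\<^bsub>F\<^esub>w\<in>S. c w \<otimes>\<^bsub>F\<^esub> w x)"
      using insert.hyps insert.prems val
      by (intro V.R.finsum_insert) (auto simp: Pi_iff subset_eq)
    ultimately show ?case
      using insert assms(7) by (simp add: V_simps(3,4))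
  qed
qed

text \<open>Stated for the whole group only; a subgroup \<open>H\<close> is covered by taking
  \<open>G\<lparr>carrier := H\<rparr>\<close> as the group.\<close>

lemma dim_invariant_space:
  assumes "field F" "group_action G X \<phi>" "finite X"
  shows "vectorspace.dim F (invariant_space F X \<phi> (carrier G)) = card (orbits G X \<phi>)"
proof -
  define V where "V = invariant_space F X \<phi> (carrier G)"
  interpret A: group_action G X \<phi> by fact
  interpret V: vectorspace F V
    unfolding V_def using assms(1,2) by (rule invariant_space_vectorspace) simp
  note V_simps = invariant_space_simps[OF assms(1), of X \<phi> "carrier G", folded V_def]
  \<comment> \<open>The restriction to \<open>X\<close> makes \<open>ind Q\<close> extensional, as
    elements of the function space have to be.\<close>
  define ind where "ind Q = (\<lambda>x\<in>X. if x \<in> Q then \<one>\<^bsub>F\<^esub> else \<zero>\<^bsub>F\<^esub>)" for Q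
  let ?B = "ind ` orbits G X \<phi>"
  have sub: "Q \<subseteq> X" if "Q \<in> orbits G X \<phi>" for Q
    using that A.orbits_coverture by blast
  have ind_eqI: "Q = P"
    if "Q \<in> orbits G X \<phi>" "P \<in> orbits G X \<phi>" "x \<in> Q" "ind P x \<noteq> \<zero>\<^bsub>F\<^esub>" for Q P x
    using that sub A.orbit_eqI[of Q P x] by (auto simp: ind_def split: if_splits)
  have ind_one: "ind Q x = \<one>\<^bsub>F\<^esub>" if "Q \<in> orbits G X \<phi>" "x \<in> Q" for Q x
    using that sub by (auto simp: ind_def)
  \<comment> \<open>Needed twice: to count the basis by orbits, and to recover an orbit from its
    indicator.\<close>
  have inj: "inj_on ind (orbits G X \<phi>)"
  proof
    fix Q P assume QP: "Q \<in> orbits G X \<phi>" "P \<in> orbits G X \<phi>" "ind Q = ind P"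
    obtain x where "x \<in> Q"
      using A.orbits_nonempty QP(1) by blast
    then show "Q = P"
      using QP ind_one[of Q x] ind_eqI[of Q P x] by simp
  qed
  have fin: "finite ?B"
    using A.finite_orbits[OF assms(3)] by simp
  have B: "?B \<subseteq> carrier V"
    using A.element_image[OF _ _ refl] A.image_mem_orbit_iff
    by (simp add: V_simps(1) ind_def image_subset_iff)
  \<comment> \<open>Both basis properties come from this evaluation: a vanishing combination has
    vanishing coefficients, and the coefficients that produce a given \<open>f\<close> must be its
    values on the orbits.\<close>
  have lincomb: "V.lincomb c ?B x = c (ind Q)"
    if c: "c \<in> ?B \<rightarrow> carrier F" and Q: "Q \<in> orbits G X \<phi>" "x \<in> Q" for c Q x
  proof -
    have x: "x \<in> X"
      using Q sub by blast
    have "V.lincomb c ?B x = (\<Oplus>\<^bsub>F\<^esub>v\<in>?B. c v \<otimes>\<^bsub>F\<^esub> v x)"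
      using invariant_space_lincomb_apply[OF assms(1,2) order_refl fin _ c x] B
      by (simp add: V_def)
    \<comment> \<open>By \<open>ind_eqI\<close> all indicators other than \<open>ind Q\<close>
      vanish at \<open>x\<close>. The conditional has the shape that
      \<open>finprod_singleton\<close>, read additively, collapses to one term.\<close>
    also have "\<dots> = (\<Oplus>\<^bsub>F\<^esub>v\<in>?B. if ind Q = v then c v else \<zero>\<^bsub>F\<^esub>)"
    proof (rule V.R.finsum_cong'[OF refl])
      show "(\<lambda>v. if ind Q = v then c v else \<zero>\<^bsub>F\<^esub>) \<in> ?B \<rightarrow> carrier F"
        using c by auto
      fix v assume v: "v \<in> ?B"
      then obtain P where P: "P \<in> orbits G X \<phi>" "v = ind P"
        by blast
      have "c v \<in> carrier F"
        using c v by blast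
      then show "c v \<otimes>\<^bsub>F\<^esub> v x = (if ind Q = v then c v else \<zero>\<^bsub>F\<^esub>)"
        using ind_one[OF Q] ind_eqI[OF Q(1) P(1) Q(2)] P(2) by (cases "ind P x = \<zero>\<^bsub>F\<^esub>") auto
    qed
    also have "\<dots> = c (ind Q)"
      using fin c Q(1) by (intro V.R.add.finprod_singleton) auto
    finally show ?thesis .
  qed
  have "V.lin_indpt ?B"
  proof (rule V.finite_lin_indpt2[OF fin B])
    fix c assume c: "c \<in> ?B \<rightarrow> carrier F" "V.lincomb c ?B = \<zero>\<^bsub>V\<^esub>"
    have "c (ind Q) = \<zero>\<^bsub>F\<^esub>" if Q: "Q \<in> orbits G X \<phi>" for Q
    proof -
      obtain x where x: "x \<in> Q"
        using A.orbits_nonempty Q by blast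
      then have "\<zero>\<^bsub>V\<^esub> x = \<zero>\<^bsub>F\<^esub>"
        using sub[OF Q] by (auto simp: V_simps(2))
      then show ?thesis
        using lincomb[OF c(1) Q x] c(2) by simp
    qed
    then show "\<forall>v\<in>?B. c v = \<zero>\<^bsub>F\<^esub>"
      by blast
  qed
  moreover have "V.gen_set ?B"
  proof
    show "V.span ?B \<subseteq> carrier V"
      using B by (rule V.span_is_subset2)
    show "carrier V \<subseteq> V.span ?B"
    proof
      fix f assume f: "f \<in> carrier V"
      \<comment> \<open>Coefficients are indexed by basis vectors, so the orbit is first recovered
        from its indicator; \<open>f\<close> is then read off at an arbitrary point of it.\<close>
      define c where "c v = f (SOME x. x \<in> the_inv_into (orbits G X \<phi>) ind v)" for v
      have c_ind: "c (ind Q) = f x" if Q: "Q \<in> orbits G X \<phi>" "x \<in> Q" for Q x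
      proof -
        define y where "y = (SOME y. y \<in> Q)"
        have y: "y \<in> Q"
          unfolding y_def using Q(2) by (rule someI)
        obtain z where z: "z \<in> X" "Q = orbit G \<phi> z"
          using Q(1) by (auto simp: orbits_def)
        \<comment> \<open>Every point of \<open>Q\<close> is \<open>\<phi> g z\<close> for some
          \<open>g\<close> in the group, so invariance makes \<open>f\<close> constant on
          \<open>Q\<close> and the choice of point harmless.\<close>
        have "f w = f z" if "w \<in> Q" for w
          using that z f by (auto simp: orbit_def V_simps(1))
        then have "f y = f x"
          using y Q(2) by simp
        then show ?thesis
          by (simp add: c_def y_def the_inv_into_f_f[OF inj Q(1)])
      qed
      have c: "c \<in> ?B \<rightarrow> carrier F"
      proof
        fix v assume "v \<in> ?B"
        then obtain Q where Q: "Q \<in> orbits G X \<phi>" "v = ind Q"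
          by blast
        obtain x where x: "x \<in> Q"
          using A.orbits_nonempty Q(1) by blast
        then show "c v \<in> carrier F"
          using c_ind[OF Q(1) x] Q sub f by (auto simp: V_simps(1))
      qed
      have "V.lincomb c ?B = f"
      \<comment> \<open>Both functions are \<open>undefined\<close> outside \<open>X\<close>, so
        comparing them on the orbits, which cover \<open>X\<close>, suffices.\<close>
      proof (rule extensionalityI)
        show "V.lincomb c ?B \<in> extensional X" "f \<in> extensional X"
          using V.lincomb_closed[OF B c] f by (auto simp: V_simps(1) PiE_def)
        fix x assume "x \<in> X"
        then obtain Q where "Q \<in> orbits G X \<phi>" "x \<in> Q"
          using A.orbits_coverture by blast
        then show "V.lincomb c ?B x = f x"
          using lincomb[OF c] c_ind by simp
      qed
      then show "f \<in> V.span ?B"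
        using V.finite_span[OF fin B] c by blast
    qed
  qed
  ultimately have "V.dim = card ?B"
    using fin B by (intro V.dim_basis) (auto simp: V.basis_def)
  then show ?thesis
    using card_image[OF inj] by (simp add: V_def)
qed

theorem theorem3p3:
  fixes F :: "('f, 'r) ring_scheme"
    and G :: "('g, 's) monoid_scheme"
    and H :: "'g set"
    and X :: "'x set"
    and \<phi> :: "'g \<Rightarrow> 'x \<Rightarrow> 'x"
  assumes "field F"
    and "group G" "finite (carrier G)"
    and "subgroup H G"
    and "finite X" "X \<noteq> {}"
    and "free_action G X \<phi>"
  shows "real (vectorspace.dim F (invariant_space F X \<phi> H))
           / real (vectorspace.dim F (invariant_space F X \<phi> (carrier G)))
         = real (card (rcosets\<^bsub>G\<^esub> H))"
proof -
  interpret G: group G by fact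
  interpret A: free_action G X \<phi> by fact
  let ?H = "G\<lparr>carrier := H\<rparr>"
  interpret B: free_action ?H X \<phi>
    using assms(4) by (rule A.induced_free_action)
  have dim_H: "vectorspace.dim F (invariant_space F X \<phi> H) = card (orbits ?H X \<phi>)"
    using dim_invariant_space[OF assms(1) B.group_action_axioms assms(5)] by simp
  have dim_G: "vectorspace.dim F (invariant_space F X \<phi> (carrier G)) = card (orbits G X \<phi>)"
    using dim_invariant_space[OF assms(1) A.group_action_axioms assms(5)] .
  \<comment> \<open>Allows \<open>card H\<close> to be cancelled once \<open>X\<close> is counted by
    \<open>H\<close>-orbits and by \<open>G\<close>-orbits.\<close>
  have H: "card H > 0"
    using assms(3,4) by (simp add: subgroup.finite_imp_card_positive)
  have "card (orbits ?H X \<phi>) * card H = card X"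
    using B.card_orbits_mult_order[OF assms(5)] by (simp add: order_def)
  also have "\<dots> = card (orbits G X \<phi>) * (card (rcosets\<^bsub>G\<^esub> H) * card H)"
    using A.card_orbits_mult_order[OF assms(5)] G.lagrange[OF assms(4)] by simp
  finally have "card (orbits ?H X \<phi>) = card (orbits G X \<phi>) * card (rcosets\<^bsub>G\<^esub> H)"
    using H by simp
  \<comment> \<open>As \<open>X\<close> is nonempty, the product of this number with the group order
    is nonzero. This rules out division by zero, where the quotient would be 0.\<close>
  moreover have "card (orbits G X \<phi>) \<noteq> 0"
    using A.card_orbits_mult_order[OF assms(5)] assms(5,6) by (metis card_0_eq mult_0)
  ultimately show ?thesis
    by (simp add: dim_H dim_G)
qed

end
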